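(* Let $\Omega$ be a separable metric space with Borel $\sigma$-algebra $\mathcal{F}$. Let $\mathcal{P}=\{P_\theta;\ \theta\in\Theta\}$ ($\Theta$ nonempty) be a family of probability measures and $\nu_1,\nu_2$ locally finite measures on $(\Omega,\mathcal{F})$ with $\mathcal{P}\ll\nu_1$ and $\mathcal{P}\ll\nu_2$. Let $(A,\nu_3)$ be a dominating pair for $(\mathcal{P},\nu_1,\nu_2)$, and let $S_\theta,S_1,S_2,S_3$ be the supports of $P_\theta$ (for each $\theta\in\Theta$), $\nu_1$, $\nu_2$ and $\nu_3$, respectively. Suppose that for every $\theta\in\Theta$ there exists a continuous version on $S_\theta$ of the Radon-Nikodým derivative $$f_{2,\theta}\in\left[\frac{dP_\theta|_{S_\theta}}{d\nu_2|_{S_\theta}}\right]_{\nu_1|_{S_\theta}},$$ and that there exists a continuous version on $S_3$ of the Radon-Nikodým derivative $$h\in\left[\frac{d\nu_2|_{S_3}}{d\nu_1|_{S_3}}\right]_{\nu_1|_{S_3}}$$ (so in particular this derivative exists). Then: 1. the continuous versions $f_{2,\theta}$ and $h$ are unique on $S_\theta$ and $S_3$, respectively; 2. for every $\theta\in\Theta$ there exists a unique continuous version on $S_\theta$ of $f_{1,\theta}\in\left[\frac{dP_\theta|_{S_\theta}}{d\nu_1|_{S_\theta}}\right]_{\nu_1|_{S_\theta}}$; 3. for each $\omega\in\Omega$, setting $\Phi_\omega=\{\theta\in\Theta;\ \omega\in S_\theta\}$, the values $f_{1,\theta}(\omega)$ and $f_{2,\theta}(\omega)$ are proportional over $\theta\in\Phi_\omega$;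 that is, there is a constant $c(\omega)$ not depending on $\theta$ such that $f_{1,\theta}(\omega)=c(\omega)f_{2,\theta}(\omega)$ for every $\theta\in\Phi_\omega$.
   Context: $\mathcal{P}\ll\nu$ means $P_\theta\ll\nu$ for every $\theta\in\Theta$. A measure $\nu$ on $(\Omega,\mathcal{F})$ is locally finite if every point of $\Omega$ has a neighbourhood of finite $\nu$-measure (such measures are $\sigma$-finite here). The support of a measure $\nu$ is the set of points $\omega\in\Omega$ such that every open neighbourhood $U$ of $\omega$ has $\nu(U)>0$. For nonempty $A\in\mathcal{F}$, $\mathcal{F}(A)=\{B\in\mathcal{F}: B\subset A\}$, and $\mu|_A$ is the restriction of a measure $\mu$ to $(A,\mathcal{F}(A))$. For a measurable real function $f$ and a measure $\mu$ on the same space, $[f]_\mu$ is the set of measurable real functions $g$ with $g=f$ $\mu$-a.e.; $\left[\frac{d\alpha}{d\beta}\right]_\mu$ denotes such a class for $f$ a version of the Radon-Nikodým derivative of $\alpha$ with respect to $\beta$. Continuity on a subset of $\Omega$ is with respect to the subspace topology. A minimal dominating measure for $\mathcal{P}$ is a $\sigma$-finite measure $\lambda$ with $\mathcal{P}\ll\lambda$ such that $\lambda\ll\mu$ for every $\sigma$-finite measure $\mu$ with $\mathcal{P}\ll\mu$. Dominating pair: $(A,\nu)$ is a dominating pair for $(\mathcal{P},\nu_1,\nu_2)$ if $A\in\mathcal{F}$; $\nu=\sum_{i=1}^\infty c_iP_{\theta_i}$ is a minimal dominating measure for $\mathcal{P}$, for some sequences $\{\theta_i\}\subset\Theta$ and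 $c_i\ge 0$ with $\sum_i c_i=1$; the measures $\nu_1|_A$, $\nu_2|_A$ and $\nu|_A$ are equivalent (mutually absolutely continuous); and $\nu(A)=1$. *)

theory Defs
  imports "HOL-Probability.Probability_Measure"
begin

(* Throughout, "absolutely_continuous M N" says N << M, with the dominating measure first. *)

definition dominates :: "'a measure \<Rightarrow> 'i set \<Rightarrow> ('i \<Rightarrow> 'a measure) \<Rightarrow> bool" where
  "dominates \<nu> \<Theta> P \<longleftrightarrow> (\<forall>\<theta>\<in>\<Theta>. absolutely_continuous \<nu> (P \<theta>))"

definition equivalent_measures :: "'a measure \<Rightarrow> 'a measure \<Rightarrow> bool" where
  "equivalent_measures M N \<longleftrightarrow> absolutely_continuous M N \<and> absolutely_continuous N M"

definition locally_finite_measure :: "'a::topological_space measure \<Rightarrow> bool" where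
  "locally_finite_measure \<nu> \<longleftrightarrow> (\<forall>x. \<exists>U. open U \<and> x \<in> U \<and> emeasure \<nu> U < \<infinity>)"

definition measure_support :: "'a::topological_space measure \<Rightarrow> 'a set" where
  "measure_support \<nu> = {\<omega>. \<forall>U. open U \<and> \<omega> \<in> U \<longrightarrow> 0 < emeasure \<nu> U}"

definition ae_class :: "'a measure \<Rightarrow> ('a \<Rightarrow> real) \<Rightarrow> ('a \<Rightarrow> real) set" where
  "ae_class \<mu> f = {g \<in> borel_measurable \<mu>. AE x in \<mu>. g x = f x}"

(* f is a real-valued version of d\<alpha>/d\<beta>. The nonnegativity clause is needed because
   ennreal sends negative reals to 0, so density alone does not see negative values of f. *)
definition RN_version :: "'a measure \<Rightarrow> 'a measure \<Rightarrow> ('a \<Rightarrow> real) \<Rightarrow> bool" where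
  "RN_version \<alpha> \<beta> f \<longleftrightarrow>
     f \<in> borel_measurable \<beta> \<and> (AE x in \<beta>. 0 \<le> f x) \<and> \<alpha> = density \<beta> (\<lambda>x. ennreal (f x))"

(* g lies in the class [d\<alpha>/d\<beta>]_\<mu> of some version of d\<alpha>/d\<beta>. The measures \<beta> and \<mu> may have
   different null sets, so g need not itself be a version of d\<alpha>/d\<beta>. *)
definition in_RN_class ::
    "'a measure \<Rightarrow> 'a measure \<Rightarrow> 'a measure \<Rightarrow> ('a \<Rightarrow> real) \<Rightarrow> bool" where
  "in_RN_class \<alpha> \<beta> \<mu> g \<longleftrightarrow> (\<exists>f. RN_version \<alpha> \<beta> f \<and> g \<in> ae_class \<mu> f)"

(* g is a version, continuous on S, of an element of [d\<alpha>|_S / d\<beta>|_S]_{\<mu>|_S}.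
   A function on S is represented by a total function whose values outside S are irrelevant. *)
definition continuous_RN_version ::
    "'a::topological_space set \<Rightarrow> 'a measure \<Rightarrow> 'a measure \<Rightarrow> 'a measure \<Rightarrow> ('a \<Rightarrow> real) \<Rightarrow> bool" where
  "continuous_RN_version S \<alpha> \<beta> \<mu> g \<longleftrightarrow>
     in_RN_class (restrict_space \<alpha> S) (restrict_space \<beta> S) (restrict_space \<mu> S) g \<and>
     continuous_on S g"

definition minimal_dominating_measure ::
    "'i set \<Rightarrow> ('i \<Rightarrow> 'a::topological_space measure) \<Rightarrow> 'a measure \<Rightarrow> bool" where
  "minimal_dominating_measure \<Theta> P lam \<longleftrightarrow>
     sets lam = sets borel \<and> sigma_finite_measure lam \<and> dominates lam \<Theta> P \<and>
     (\<forall>\<mu>. sets \<mu> = sets borel \<and> sigma_finite_measure \<mu> \<and> dominates \<mu> \<Theta> P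
        \<longrightarrow> absolutely_continuous \<mu> lam)"

definition dominating_pair ::
    "'i set \<Rightarrow> ('i \<Rightarrow> 'a::topological_space measure) \<Rightarrow> 'a measure \<Rightarrow> 'a measure
      \<Rightarrow> 'a set \<Rightarrow> 'a measure \<Rightarrow> bool" where
  "dominating_pair \<Theta> P \<nu>\<^sub>1 \<nu>\<^sub>2 A \<nu> \<longleftrightarrow>
     A \<in> sets borel \<and>
     minimal_dominating_measure \<Theta> P \<nu> \<and>
     (\<exists>(t :: nat \<Rightarrow> 'i) (c :: nat \<Rightarrow> real).
        range t \<subseteq> \<Theta> \<and> (\<forall>i. 0 \<le> c i) \<and> c sums 1 \<and>
        (\<forall>B\<in>sets borel. emeasure \<nu> B = (\<Sum>i. ennreal (c i) * emeasure (P (t i)) B))) \<and>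
     equivalent_measures (restrict_space \<nu>\<^sub>1 A) (restrict_space \<nu>\<^sub>2 A) \<and>
     equivalent_measures (restrict_space \<nu>\<^sub>1 A) (restrict_space \<nu> A) \<and>
     equivalent_measures (restrict_space \<nu>\<^sub>2 A) (restrict_space \<nu> A) \<and>
     emeasure \<nu> A = 1"

end

theory Submission
  imports Defs
begin

text \<open>
  Two elements of a Radon-Nikodym class agree off the union of a null set of each of the two
  reference measures, hence \<open>Q\<close>-almost everywhere for every \<open>Q\<close> dominated by both. If they are continuous on the
  support of \<open>Q\<close>, they must agree there, as a discrepancy would occur on a relatively open set
  of positive \<open>Q\<close>-measure. Existence and proportionality follow from the chain rule
  \<open>dP\<^sub>\<theta>/d\<nu>\<^sub>1 = dP\<^sub>\<theta>/d\<nu>\<^sub>2 \<cdot> d\<nu>\<^sub>2/d\<nu>\<^sub>1\<close>: since \<open>S\<^sub>\<theta> \<subseteq> S\<^sub>3\<close>, the function \<open>f\<^sub>2\<^sub>\<theta> h\<close> is continuous on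
  \<open>S\<^sub>\<theta>\<close>, and its proportionality factor \<open>h(\<omega>)\<close> does not involve \<open>\<theta>\<close>.
\<close>

section \<open>Countable bases and supports of Borel measures\<close>

text \<open>Turns separability into a countable base, the form in which the later lemmas use it:
  balls of radius \<open>1 / Suc n\<close> around a countable dense set.\<close>

lemma second_countable_euclidean_if_separable:
  assumes "separable_space (euclidean :: 'a::metric_space topology)"
  shows "second_countable (euclidean :: 'a topology)"
proof -
  obtain D :: "'a set" where D: "countable D" "closure D = UNIV"
    using assms by (auto simp: separable_space_def)
  define \<B> where "\<B> = (\<lambda>(d, n). ball d (1 / real (Suc n))) ` (D \<times> UNIV)"
  have "countable \<B>"
    unfolding \<B>_def using D(1) by simp
  moreover have "\<forall>V\<in>\<B>. open V"
    by (auto simp: \<B>_def)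
  moreover have "\<exists>V\<in>\<B>. x \<in> V \<and> V \<subseteq> U" if U: "open U" "x \<in> U" for U x
  proof -
    obtain e where e: "e > 0" "ball x e \<subseteq> U"
      using openE[OF U] by blast
    \<comment> \<open>Half of \<open>e\<close>, because a point of the ball around \<open>d\<close>
      is reached from \<open>x\<close> through \<open>d\<close>, at a cost of two radii.\<close>
    obtain n where n: "1 / real (Suc n) < e / 2"
      using nat_approx_posE[of "e / 2"] e by auto
    obtain d where d: "d \<in> D" "dist d x < 1 / real (Suc n)"
    proof -
      have "x \<in> closure D" "0 < 1 / real (Suc n)"
        by (simp_all add: D(2))
      then show ?thesis
        unfolding closure_approachable using that by blast
    qed
    have "ball d (1 / real (Suc n)) \<subseteq> ball x e"
    proof
      fix y assume "y \<in> ball d (1 / real (Suc n))"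
      with d n show "y \<in> ball x e"
        using dist_triangle[of x y d] by (simp add: dist_commute)
    qed
    moreover have "ball d (1 / real (Suc n)) \<in> \<B>"
      using d(1) unfolding \<B>_def by (intro image_eqI[of _ _ "(d, n)"]) auto
    moreover have "x \<in> ball d (1 / real (Suc n))"
      using d(2) unfolding mem_ball .
    ultimately show ?thesis
      using e(2) by blast
  qed
  ultimately show ?thesis
    unfolding second_countable_def by (intro exI[of _ \<B>]) simp
qed

lemma closed_measure_support: "closed (measure_support M)"
proof -
  have "open (- measure_support M)"
    unfolding measure_support_def
    by (subst open_subopen) (auto simp: zero_less_iff_neq_zero)
  then show ?thesis
    by (simp add: closed_def)
qed

text \<open>Every point outside the support has an open null neighbourhood, which can be shrunk to a
  base set; countably many null base sets thus cover the complement.\<close>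

lemma null_sets_compl_measure_support:
  fixes M :: "'a::topological_space measure"
  assumes "second_countable (euclidean :: 'a topology)" and sets: "sets M = sets borel"
  shows "- measure_support M \<in> null_sets M"
proof -
  obtain \<B> :: "'a set set" where \<B>: "countable \<B>" "\<And>V. V \<in> \<B> \<Longrightarrow> open V"
      "\<And>U x. open U \<Longrightarrow> x \<in> U \<Longrightarrow> \<exists>V\<in>\<B>. x \<in> V \<and> V \<subseteq> U"
    using assms by (auto simp: second_countable_def)
  define \<N> where "\<N> = {V \<in> \<B>. emeasure M V = 0}"
  have "\<Union>\<N> \<in> null_sets M"
  proof -
    have "countable \<N>" "\<And>V. V \<in> \<N> \<Longrightarrow> V \<in> null_sets M"
      using \<B>(1,2) by (simp_all add: \<N>_def null_sets_def sets)
    then show ?thesis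
      using null_sets_UN'[of \<N> "\<lambda>V. V" M] by simp
  qed
  moreover have "- measure_support M \<subseteq> \<Union>\<N>"
  proof
    fix x assume "x \<in> - measure_support M"
    then obtain U where U: "open U" "x \<in> U" "emeasure M U = 0"
      by (auto simp: measure_support_def zero_less_iff_neq_zero)
    obtain V where V: "V \<in> \<B>" "x \<in> V" "V \<subseteq> U"
      using \<B>(3)[OF U(1,2)] by blast
    then have "emeasure M V = 0"
      using U(1,3) emeasure_mono[of V U M] by (simp add: sets)
    then show "x \<in> \<Union>\<N>"
      using V by (auto simp: \<N>_def)
  qed
  moreover have "- measure_support M \<in> sets M"
    using closed_measure_support[of M] by (simp add: sets)
  ultimately show ?thesis
    using null_sets_subset by blast
qed

lemma AE_in_measure_support:
  fixes M :: "'a::topological_space measure"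
  assumes "second_countable (euclidean :: 'a topology)" and "sets M = sets borel"
  shows "AE x in M. x \<in> measure_support M"
  using AE_not_in[OF null_sets_compl_measure_support[OF assms]] by simp

text \<open>Open null sets of \<open>M\<close> are null for \<open>N\<close>. This will place each
  \<open>S \<theta>\<close> inside \<open>S\<^sub>3\<close>.\<close>

lemma measure_support_mono:
  assumes "absolutely_continuous M N" and "sets M = sets borel"
  shows "measure_support N \<subseteq> measure_support M"
proof -
  have "emeasure N U = 0" if "open U" "emeasure M U = 0" for U
  proof -
    have "U \<in> null_sets M"
      using that assms(2) by (simp add: null_sets_def)
    then show ?thesis
      using assms(1) unfolding absolutely_continuous_def by blast
  qed
  then show ?thesis
    unfolding measure_support_def zero_less_iff_neq_zero by blast
qed

text \<open>The base sets of finite measure already cover the space, since a neighbourhood of finite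
  measure contains a base set around its point.\<close>

lemma sigma_finite_if_locally_finite:
  fixes M :: "'a::topological_space measure"
  assumes "second_countable (euclidean :: 'a topology)" and sets: "sets M = sets borel"
    and lf: "locally_finite_measure M"
  shows "sigma_finite_measure M"
proof -
  obtain \<B> :: "'a set set" where \<B>: "countable \<B>" "\<And>V. V \<in> \<B> \<Longrightarrow> open V"
      "\<And>U x. open U \<Longrightarrow> x \<in> U \<Longrightarrow> \<exists>V\<in>\<B>. x \<in> V \<and> V \<subseteq> U"
    using assms(1) by (auto simp: second_countable_def)
  define \<C> where "\<C> = {V \<in> \<B>. emeasure M V < \<infinity>}"
  have "x \<in> \<Union>\<C>" for x
  proof -
    obtain U where U: "open U" "x \<in> U" "emeasure M U < \<infinity>"
      using lf by (auto simp: locally_finite_measure_def)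
    obtain V where V: "V \<in> \<B>" "x \<in> V" "V \<subseteq> U"
      using \<B>(3)[OF U(1,2)] by blast
    then have "emeasure M V < \<infinity>"
      using U(1,3) emeasure_mono[of V U M] by (simp add: sets order.strict_trans1)
    then show ?thesis
      using V by (auto simp: \<C>_def)
  qed
  then have "\<Union>\<C> = space M"
    using sets_eq_imp_space_eq[OF sets] by auto
  moreover have "countable \<C>" "\<C> \<subseteq> sets M"
    using \<B>(1,2) by (simp_all add: \<C>_def sets subset_iff)
  moreover have "\<forall>V\<in>\<C>. emeasure M V \<noteq> \<infinity>"
    by (simp add: \<C>_def less_top)
  ultimately show ?thesis
    unfolding sigma_finite_measure_def by blast
qed

section \<open>Uniqueness of continuous versions\<close>

lemma continuous_on_eq_on_measure_support:
  fixes Q :: "'a::topological_space measure" and f g :: "'a \<Rightarrow> 'b::t2_space"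
  assumes "second_countable (euclidean :: 'a topology)" and sets: "sets Q = sets borel"
    and "continuous_on (measure_support Q) f" and "continuous_on (measure_support Q) g"
    and ae: "AE x in Q. x \<in> measure_support Q \<longrightarrow> f x = g x"
    and x: "x \<in> measure_support Q"
  shows "f x = g x"
proof (rule ccontr)
  assume neq: "f x \<noteq> g x"
  obtain V W where VW: "open V" "open W" "f x \<in> V" "g x \<in> W" "V \<inter> W = {}"
    using hausdorff[OF neq] by blast
  \<comment> \<open>Continuity on the support only makes preimages relatively open.
    \<open>U1\<close> and \<open>U2\<close> are extensions open in the whole space, which is what
    the definition of the support tests.\<close>
  obtain U1 where U1: "open U1" "U1 \<inter> measure_support Q = f -` V \<inter> measure_support Q"
    using assms(3) VW(1) by (auto simp: continuous_on_open_invariant)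
  obtain U2 where U2: "open U2" "U2 \<inter> measure_support Q = g -` W \<inter> measure_support Q"
    using assms(4) VW(2) by (auto simp: continuous_on_open_invariant)
  have "x \<in> U1 \<inter> U2"
    using U1 U2 VW x by auto
  have disc: "f y \<noteq> g y" if "y \<in> U1 \<inter> U2" "y \<in> measure_support Q" for y
  proof -
    have "f y \<in> V" "g y \<in> W"
      using that U1(2) U2(2) by auto
    then show ?thesis
      using VW(5) by auto
  qed
  \<comment> \<open>\<open>disc\<close> speaks only of points of the support; the remaining points
    of \<open>U1 \<inter> U2\<close> form a null set.\<close>
  have "AE y in Q. y \<notin> U1 \<inter> U2"
    using ae AE_in_measure_support[OF assms(1,2)]
    by eventually_elim (use disc in blast)
  then have "U1 \<inter> U2 \<in> null_sets Q"
    using U1 U2 sets sets_eq_imp_space_eq[OF sets] by (subst AE_iff_null_sets) (auto intro: borel_open)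
  then have "emeasure Q (U1 \<inter> U2) = 0"
    by blast
  moreover have "0 < emeasure Q (U1 \<inter> U2)"
    using x \<open>x \<in> U1 \<inter> U2\<close> open_Int[OF U1(1) U2(1)] unfolding measure_support_def by blast
  ultimately show False
    by simp
qed

text \<open>Uniqueness of densities compares values only after \<open>ennreal\<close>, which
  identifies all negative reals with 0; the nonnegativity clause of \<open>RN_version\<close>
  restores equality of the real values.\<close>

lemma RN_version_unique:
  assumes "sigma_finite_measure \<beta>" and f: "RN_version \<alpha> \<beta> f" and g: "RN_version \<alpha> \<beta> g"
  shows "AE x in \<beta>. f x = g x"
proof -
  have "AE x in \<beta>. ennreal (f x) = ennreal (g x)"
    using f g by (intro sigma_finite_measure.density_unique[OF assms(1)])
      (auto simp: RN_version_def)
  moreover have "AE x in \<beta>. 0 \<le> f x" "AE x in \<beta>. 0 \<le> g x"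
    using f g by (auto simp: RN_version_def)
  ultimately show ?thesis
    by eventually_elim simp
qed

lemma AE_restrict_space_borel:
  assumes "sets M = sets borel" and "S \<in> sets borel"
  shows "(AE x in restrict_space M S. R x) \<longleftrightarrow> (AE x in M. x \<in> S \<longrightarrow> R x)"
  using assms by (intro AE_restrict_space_iff) auto

text \<open>The chain is \<open>f = f' = g' = g\<close> on \<open>S\<close>: the middle equality
  holds up to a null set of \<open>\<beta>\<close>, the outer two up to null sets of
  \<open>\<mu>\<close>. Hence \<open>Q\<close> is dominated by both.\<close>

lemma in_RN_class_restrict_space_AE_eq:
  assumes S: "S \<in> sets borel"
    and sets: "sets \<beta> = sets borel" "sets \<mu> = sets borel" "sets Q = sets borel"
    and sf: "sigma_finite_measure \<beta>"
    and ac: "absolutely_continuous \<beta> Q" "absolutely_continuous \<mu> Q"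
    and f: "in_RN_class (restrict_space \<alpha> S) (restrict_space \<beta> S) (restrict_space \<mu> S) f"
    and g: "in_RN_class (restrict_space \<alpha> S) (restrict_space \<beta> S) (restrict_space \<mu> S) g"
  shows "AE x in Q. x \<in> S \<longrightarrow> f x = g x"
proof -
  obtain f' where f': "RN_version (restrict_space \<alpha> S) (restrict_space \<beta> S) f'"
      "AE x in restrict_space \<mu> S. f x = f' x"
    using f by (auto simp: in_RN_class_def ae_class_def)
  obtain g' where g': "RN_version (restrict_space \<alpha> S) (restrict_space \<beta> S) g'"
      "AE x in restrict_space \<mu> S. g x = g' x"
    using g by (auto simp: in_RN_class_def ae_class_def)
  have "AE x in restrict_space \<beta> S. f' x = g' x"
    using S by (intro RN_version_unique[OF _ f'(1) g'(1)] sigma_finite_measure_restrict_space sf)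
      (simp add: sets)
  \<comment> \<open>Absolute continuity is available for the unrestricted measures, so statements on
    \<open>S\<close> are turned into implications before being transferred.\<close>
  then have "AE x in Q. x \<in> S \<longrightarrow> f' x = g' x"
    by (intro absolutely_continuous_AE[OF _ ac(1)])
       (simp_all add: AE_restrict_space_borel S sets)
  moreover have "AE x in Q. x \<in> S \<longrightarrow> f x = f' x" "AE x in Q. x \<in> S \<longrightarrow> g x = g' x"
    using f'(2) g'(2)
    by (intro absolutely_continuous_AE[OF _ ac(2)]; simp add: AE_restrict_space_borel S sets)+
  ultimately show ?thesis
    by eventually_elim simp
qed

text \<open>\<open>Q\<close> is kept separate from \<open>\<alpha>\<close> because the derivative
  \<open>h\<close> of \<open>\<nu>\<^sub>2\<close> is studied on the support of
  \<open>\<nu>\<^sub>3\<close>.\<close>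

lemma continuous_RN_version_unique:
  fixes Q :: "'a::topological_space measure"
  assumes sc: "second_countable (euclidean :: 'a topology)"
    and sets: "sets \<beta> = sets borel" "sets \<mu> = sets borel" "sets Q = sets borel"
    and sf: "sigma_finite_measure \<beta>"
    and ac: "absolutely_continuous \<beta> Q" "absolutely_continuous \<mu> Q"
    and f: "continuous_RN_version (measure_support Q) \<alpha> \<beta> \<mu> f"
    and g: "continuous_RN_version (measure_support Q) \<alpha> \<beta> \<mu> g"
    and x: "x \<in> measure_support Q"
  shows "f x = g x"
proof (rule continuous_on_eq_on_measure_support[OF sc sets(3) _ _ _ x])
  show "AE x in Q. x \<in> measure_support Q \<longrightarrow> f x = g x"
    using f g closed_measure_support[of Q]
    by (intro in_RN_class_restrict_space_AE_eq[OF _ sets sf ac])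
      (auto simp: continuous_RN_version_def)
qed (use f g in \<open>auto simp: continuous_RN_version_def\<close>)

section \<open>Restriction and the chain rule\<close>

text \<open>Needed to pass from the derivative on \<open>S\<^sub>3\<close> to the one on the smaller
  set \<open>S \<theta>\<close>.\<close>

lemma RN_version_restrict_space:
  assumes "RN_version \<alpha> \<beta> f" and "S \<inter> space \<beta> \<in> sets \<beta>"
  shows "RN_version (restrict_space \<alpha> S) (restrict_space \<beta> S) f"
proof -
  have f: "f \<in> borel_measurable \<beta>" "AE x in \<beta>. 0 \<le> f x" "\<alpha> = density \<beta> (\<lambda>x. ennreal (f x))"
    using assms(1) by (auto simp: RN_version_def)
  have "restrict_space \<alpha> S = density (restrict_space \<beta> S) (\<lambda>x. ennreal (f x))"
  proof (rule measure_eqI)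
    show "sets (restrict_space \<alpha> S) = sets (density (restrict_space \<beta> S) (\<lambda>x. ennreal (f x)))"
      by (simp add: f(3) sets_restrict_space)
    fix B assume "B \<in> sets (restrict_space \<alpha> S)"
    then have B: "B \<in> sets \<beta>" "B \<subseteq> S" "B \<in> sets (restrict_space \<beta> S)"
      using assms(2) by (auto simp: f(3) sets_restrict_space_iff sets_density cong: sets_restrict_space_cong)
    have "emeasure (restrict_space \<alpha> S) B = (\<integral>\<^sup>+x. ennreal (f x) * indicator B x \<partial>\<beta>)"
      using B assms(2) f by (simp add: emeasure_restrict_space emeasure_density)
    also have "\<dots> = (\<integral>\<^sup>+x. ennreal (f x) * indicator B x * indicator S x \<partial>\<beta>)"
      using B by (intro nn_integral_cong) (auto simp: indicator_def)
    also have "\<dots> = emeasure (density (restrict_space \<beta> S) (\<lambda>x. ennreal (f x))) B"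
      using B assms(2) f
      by (simp add: emeasure_density nn_integral_restrict_space measurable_restrict_space1)
    finally show "emeasure (restrict_space \<alpha> S) B =
        emeasure (density (restrict_space \<beta> S) (\<lambda>x. ennreal (f x))) B" .
  qed
  then show ?thesis
    using f assms(2) by (auto simp: RN_version_def AE_restrict_space_iff measurable_restrict_space1)
qed

lemma RN_version_chain:
  assumes f: "RN_version \<alpha> \<beta> f" and h: "RN_version \<beta> \<mu> h"
  shows "RN_version \<alpha> \<mu> (\<lambda>x. f x * h x)"
proof -
  have h': "h \<in> borel_measurable \<mu>" "AE x in \<mu>. 0 \<le> h x" "\<beta> = density \<mu> (\<lambda>x. ennreal (h x))"
    using h by (auto simp: RN_version_def)
  have f': "f \<in> borel_measurable \<mu>" "AE x in \<beta>. 0 \<le> f x" "\<alpha> = density \<beta> (\<lambda>x. ennreal (f x))"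
    using f h'(3) by (auto simp: RN_version_def)
  \<comment> \<open>A \<open>\<beta>\<close>-null set may have positive
    \<open>\<mu>\<close>-measure, but up to a \<open>\<mu>\<close>-null set it lies where
    \<open>h\<close> vanishes, and there the product is 0.\<close>
  have "AE x in \<mu>. 0 < ennreal (h x) \<longrightarrow> 0 \<le> f x"
    using f'(2) h'(1) unfolding h'(3) by (subst (asm) AE_density) auto
  then have "AE x in \<mu>. 0 \<le> f x * h x"
    using h'(2) by eventually_elim (auto simp: ennreal_zero_less_mult_iff less_le)
  moreover have "density \<beta> (\<lambda>x. ennreal (f x)) = density \<mu> (\<lambda>x. ennreal (f x * h x))"
    unfolding h'(3)
  proof (subst density_density_eq)
    show "density \<mu> (\<lambda>x. ennreal (h x) * ennreal (f x)) = density \<mu> (\<lambda>x. ennreal (f x * h x))"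
    proof (rule density_cong)
      \<comment> \<open>The sign of \<open>h\<close> suffices: where \<open>f x\<close> is negative,
        both sides are 0.\<close>
      show "AE x in \<mu>. ennreal (h x) * ennreal (f x) = ennreal (f x * h x)"
        using h'(2) by eventually_elim (simp add: ennreal_mult'' mult.commute)
    qed (use f' h' in measurable)
  qed (use f' h' in measurable)
  ultimately show ?thesis
    using f' h' by (auto simp: RN_version_def)
qed

text \<open>Both classes are taken modulo \<open>\<mu>\<close>, so \<open>f * h\<close> agrees
  \<open>\<mu>\<close>-almost everywhere on \<open>S\<close> with the product of the underlying
  versions, to which the chain rule applies.\<close>

lemma continuous_RN_version_chain:
  assumes S: "S \<in> sets borel" "T \<in> sets borel" "S \<subseteq> T"
    and sets: "sets \<beta> = sets borel" "sets \<mu> = sets borel"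
    and f: "continuous_RN_version S \<alpha> \<beta> \<mu> f" and h: "continuous_RN_version T \<beta> \<mu> \<mu> h"
  shows "continuous_RN_version S \<alpha> \<mu> \<mu> (\<lambda>x. f x * h x)"
proof -
  have S': "S \<inter> space M \<in> sets M" "T \<inter> space M \<in> sets M" if "sets M = sets borel" for M
    using S that by auto
  \<comment> \<open>The version \<open>h'\<close> lives on \<open>T\<close>; restricting it further
    to \<open>S\<close> produces nested restrictions, collapsed here.\<close>
  have restr: "restrict_space (restrict_space M T) S = restrict_space M S"
    if "sets M = sets borel" for M
    using restrict_restrict_space[OF S'(2,1)[OF that]] S(3) by (simp add: Int_absorb1)
  obtain f' where f': "RN_version (restrict_space \<alpha> S) (restrict_space \<beta> S) f'"
      "f \<in> borel_measurable (restrict_space \<mu> S)" "AE x in restrict_space \<mu> S. f x = f' x"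
    using f by (auto simp: continuous_RN_version_def in_RN_class_def ae_class_def)
  obtain h' where h': "RN_version (restrict_space \<beta> T) (restrict_space \<mu> T) h'"
      "h \<in> borel_measurable (restrict_space \<mu> T)" "AE x in restrict_space \<mu> T. h x = h' x"
    using h by (auto simp: continuous_RN_version_def in_RN_class_def ae_class_def)
  have ST: "S \<inter> space (restrict_space \<mu> T) \<in> sets (restrict_space \<mu> T)"
    using S S'[OF sets(2)] sets_eq_imp_space_eq[OF sets(2)]
    by (simp add: space_restrict_space sets_restrict_space_iff sets Int_absorb2)
  have "RN_version (restrict_space \<beta> S) (restrict_space \<mu> S) h'"
    using RN_version_restrict_space[OF h'(1) ST] by (simp add: restr sets)
  then have "RN_version (restrict_space \<alpha> S) (restrict_space \<mu> S) (\<lambda>x. f' x * h' x)"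
    by (rule RN_version_chain[OF f'(1)])
  moreover have hS: "h \<in> borel_measurable (restrict_space \<mu> S)"
    using measurable_restrict_space1[OF h'(2), of S] by (simp add: restr sets)
  moreover have "AE x in \<mu>. x \<in> T \<longrightarrow> h x = h' x"
    using h'(3) by (simp add: AE_restrict_space_borel S sets)
  then have "AE x in restrict_space \<mu> S. h x = h' x"
    unfolding AE_restrict_space_borel[OF sets(2) S(1)] by eventually_elim (use S(3) in blast)
  then have "AE x in restrict_space \<mu> S. f x * h x = f' x * h' x"
    using f'(3) by eventually_elim simp
  ultimately show ?thesis
    using f h S(3) f'(2)
    by (auto simp: continuous_RN_version_def in_RN_class_def ae_class_def
        intro!: continuous_on_mult intro: continuous_on_subset)
qed

section \<open>Uniqueness, existence and proportionality on the supports\<close>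

theorem proposition3:
  fixes \<Theta> :: "'i set"
    and P :: "'i \<Rightarrow> 'a::metric_space measure"
    and \<nu>\<^sub>1 \<nu>\<^sub>2 \<nu>\<^sub>3 :: "'a measure"
    and A :: "'a set"
    and S :: "'i \<Rightarrow> 'a set"
    and S\<^sub>3 :: "'a set"
    and f\<^sub>2 :: "'i \<Rightarrow> 'a \<Rightarrow> real"
    and h :: "'a \<Rightarrow> real"
  assumes "separable_space (euclidean :: 'a topology)"
    and "\<Theta> \<noteq> {}"
    and "\<And>\<theta>. \<theta> \<in> \<Theta> \<Longrightarrow> prob_space (P \<theta>)"
    and "\<And>\<theta>. \<theta> \<in> \<Theta> \<Longrightarrow> sets (P \<theta>) = sets borel"
    and "sets \<nu>\<^sub>1 = sets borel" and "locally_finite_measure \<nu>\<^sub>1"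
    and "sets \<nu>\<^sub>2 = sets borel" and "locally_finite_measure \<nu>\<^sub>2"
    and "dominates \<nu>\<^sub>1 \<Theta> P" and "dominates \<nu>\<^sub>2 \<Theta> P"
    and "dominating_pair \<Theta> P \<nu>\<^sub>1 \<nu>\<^sub>2 A \<nu>\<^sub>3"
    and "\<And>\<theta>. \<theta> \<in> \<Theta> \<Longrightarrow> S \<theta> = measure_support (P \<theta>)"
    and "S\<^sub>3 = measure_support \<nu>\<^sub>3"
    and "\<And>\<theta>. \<theta> \<in> \<Theta> \<Longrightarrow> continuous_RN_version (S \<theta>) (P \<theta>) \<nu>\<^sub>2 \<nu>\<^sub>1 (f\<^sub>2 \<theta>)"
    and "continuous_RN_version S\<^sub>3 \<nu>\<^sub>2 \<nu>\<^sub>1 \<nu>\<^sub>1 h"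
  shows "(\<forall>\<theta>\<in>\<Theta>. \<forall>g. continuous_RN_version (S \<theta>) (P \<theta>) \<nu>\<^sub>2 \<nu>\<^sub>1 g \<longrightarrow> (\<forall>\<omega>\<in>S \<theta>. g \<omega> = f\<^sub>2 \<theta> \<omega>)) \<and>
    (\<forall>g. continuous_RN_version S\<^sub>3 \<nu>\<^sub>2 \<nu>\<^sub>1 \<nu>\<^sub>1 g \<longrightarrow> (\<forall>\<omega>\<in>S\<^sub>3. g \<omega> = h \<omega>)) \<and>
    (\<exists>f\<^sub>1 :: 'i \<Rightarrow> 'a \<Rightarrow> real.
      (\<forall>\<theta>\<in>\<Theta>. continuous_RN_version (S \<theta>) (P \<theta>) \<nu>\<^sub>1 \<nu>\<^sub>1 (f\<^sub>1 \<theta>) \<and>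
        (\<forall>g. continuous_RN_version (S \<theta>) (P \<theta>) \<nu>\<^sub>1 \<nu>\<^sub>1 g \<longrightarrow> (\<forall>\<omega>\<in>S \<theta>. g \<omega> = f\<^sub>1 \<theta> \<omega>))) \<and>
      (\<forall>\<omega>. \<exists>c::real. \<forall>\<theta>\<in>{\<theta> \<in> \<Theta>. \<omega> \<in> S \<theta>}. f\<^sub>1 \<theta> \<omega> = c * f\<^sub>2 \<theta> \<omega>))"
proof -
  have sc: "second_countable (euclidean :: 'a topology)"
    using assms(1) by (rule second_countable_euclidean_if_separable)
  have sf: "sigma_finite_measure \<nu>\<^sub>1" "sigma_finite_measure \<nu>\<^sub>2"
    by (rule sigma_finite_if_locally_finite[OF sc]; fact)+
  have minimal: "minimal_dominating_measure \<Theta> P \<nu>\<^sub>3"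
    using assms(11) by (simp add: dominating_pair_def)
  then have sets3: "sets \<nu>\<^sub>3 = sets borel" and dom3: "dominates \<nu>\<^sub>3 \<Theta> P"
    by (simp_all add: minimal_dominating_measure_def)
  \<comment> \<open>Minimality of \<open>\<nu>\<^sub>3\<close> is tested against the sigma-finite
    dominating measure \<open>\<nu>\<^sub>1\<close>; this permits \<open>Q = \<nu>\<^sub>3\<close>
    in the uniqueness of \<open>h\<close>.\<close>
  have ac31: "absolutely_continuous \<nu>\<^sub>1 \<nu>\<^sub>3"
    using minimal assms(5,9) sf(1) unfolding minimal_dominating_measure_def by blast
  have ac: "absolutely_continuous \<nu>\<^sub>1 (P \<theta>)" "absolutely_continuous \<nu>\<^sub>2 (P \<theta>)" if "\<theta> \<in> \<Theta>" for \<theta>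
    using that assms(9,10) by (auto simp: dominates_def)
  have sub: "S \<theta> \<subseteq> S\<^sub>3" if "\<theta> \<in> \<Theta>" for \<theta>
    unfolding assms(12)[OF that] assms(13)
    using that dom3 sets3 by (intro measure_support_mono) (simp_all add: dominates_def)
  \<comment> \<open>Stated for a general denominator \<open>\<nu>\<close>, to serve both
    \<open>\<nu>\<^sub>1\<close> and \<open>\<nu>\<^sub>2\<close>; the class is modulo
    \<open>\<nu>\<^sub>1\<close> in either case.\<close>
  have uniq: "g \<omega> = g' \<omega>"
    if \<theta>: "\<theta> \<in> \<Theta>" and \<omega>: "\<omega> \<in> S \<theta>"
      and \<nu>: "sets \<nu> = sets borel" "sigma_finite_measure \<nu>" "absolutely_continuous \<nu> (P \<theta>)"
      and g: "continuous_RN_version (S \<theta>) (P \<theta>) \<nu> \<nu>\<^sub>1 g"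
      and g': "continuous_RN_version (S \<theta>) (P \<theta>) \<nu> \<nu>\<^sub>1 g'"
    for \<theta> \<omega> \<nu> g g'
    using \<omega> g g' unfolding assms(12)[OF \<theta>]
    by (intro continuous_RN_version_unique[OF sc \<nu>(1) assms(5) assms(4)[OF \<theta>] \<nu>(2,3) ac(1)[OF \<theta>]])
  note uniq1 = uniq[OF _ _ assms(5) sf(1) ac(1)]
  note uniq2 = uniq[OF _ _ assms(7) sf(2) ac(2)]
  have uniq_h: "g \<omega> = h \<omega>" if "\<omega> \<in> S\<^sub>3" "continuous_RN_version S\<^sub>3 \<nu>\<^sub>2 \<nu>\<^sub>1 \<nu>\<^sub>1 g" for \<omega> g
    using that assms(15) unfolding assms(13)
    by (intro continuous_RN_version_unique[OF sc assms(5) assms(5) sets3 sf(1) ac31 ac31])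
  define f\<^sub>1 where "f\<^sub>1 \<theta> \<omega> = f\<^sub>2 \<theta> \<omega> * h \<omega>" for \<theta> \<omega>
  have f1: "continuous_RN_version (S \<theta>) (P \<theta>) \<nu>\<^sub>1 \<nu>\<^sub>1 (f\<^sub>1 \<theta>)" if "\<theta> \<in> \<Theta>" for \<theta>
    unfolding f\<^sub>1_def
  proof (rule continuous_RN_version_chain[OF _ _ sub[OF that] assms(7) assms(5) assms(14)[OF that] assms(15)])
    show "S \<theta> \<in> sets borel" "S\<^sub>3 \<in> sets borel"
      unfolding assms(12)[OF that] assms(13) by (intro borel_closed closed_measure_support)+
  qed
  \<comment> \<open>The constant is \<open>c = h \<omega>\<close>.\<close>
  have "\<forall>\<omega>. \<exists>c. \<forall>\<theta>\<in>{\<theta> \<in> \<Theta>. \<omega> \<in> S \<theta>}. f\<^sub>1 \<theta> \<omega> = c * f\<^sub>2 \<theta> \<omega>"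
    unfolding f\<^sub>1_def by (metis mult.commute)
  moreover have "\<forall>\<theta>\<in>\<Theta>. continuous_RN_version (S \<theta>) (P \<theta>) \<nu>\<^sub>1 \<nu>\<^sub>1 (f\<^sub>1 \<theta>) \<and>
      (\<forall>g. continuous_RN_version (S \<theta>) (P \<theta>) \<nu>\<^sub>1 \<nu>\<^sub>1 g \<longrightarrow> (\<forall>\<omega>\<in>S \<theta>. g \<omega> = f\<^sub>1 \<theta> \<omega>))"
    using f1 uniq1 by blast
  moreover have "\<forall>\<theta>\<in>\<Theta>. \<forall>g. continuous_RN_version (S \<theta>) (P \<theta>) \<nu>\<^sub>2 \<nu>\<^sub>1 g \<longrightarrow>
      (\<forall>\<omega>\<in>S \<theta>. g \<omega> = f\<^sub>2 \<theta> \<omega>)"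
    using assms(14) uniq2 by blast
  moreover have "\<forall>g. continuous_RN_version S\<^sub>3 \<nu>\<^sub>2 \<nu>\<^sub>1 \<nu>\<^sub>1 g \<longrightarrow> (\<forall>\<omega>\<in>S\<^sub>3. g \<omega> = h \<omega>)"
    using uniq_h by blast
  ultimately show ?thesis
    by (intro conjI exI[of _ f\<^sub>1])
qed

end
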